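(* Let $n_1,n_2,w_1,w_2$ be nonnegative integers with $w_1\le n_1$ and $w_2\le n_2$, let $n=n_1+n_2$ and $w=w_1+w_2$, and let $d$ be an integer with $1\le d\le n$. Then $$A(n,d,w)\le \frac{\binom{n_1+n_2}{w_1+w_2}}{\binom{n_1}{w_1}\binom{n_2}{w_2}}\,T(w_1,n_1,w_2,n_2,d)$$ and $$A(n,d)\le \frac{2^n}{\sum_{i=0}^{w_1}\binom{n_1}{i}\binom{n_2}{w_1+w_2-i}}\,T'(w_1,n_1,w_2,n_2,d).$$
   Context: All codes are binary, i.e. subsets of $\{0,1\}^n$; a code has minimum distance at least $d$ if any two distinct codewords differ in at least $d$ positions; the weight of a codeword is its number of nonzero entries. - $A(n,d)$ is the maximum number of codewords in a code of length $n$ with minimum distance at least $d$. - $A(n,d,w)$ is the maximum number of codewords in such a code all of whose codewords have weight $w$. - $T(w_1,n_1,w_2,n_2,d)$ is the maximum number of codewords in a code of length $n=n_1+n_2$ with minimum distance at least $d$, all of whose codewords have weight $w=w_1+w_2$ and have exactly $w_1$ ones among the first $n_1$ entries. - $T'(w_1,n_1,w_2,n_2,d)$ is defined in the same way (length $n_1+n_2$, constant weight $w_1+w_2$, minimum distance at least $d$), except that every codeword is required to have at most $w_1$ ones among its first $n_1$ entries. Convention: $\binom{m}{k}=0$ when $k>m$. *)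

theory Defs
  imports Complex_Main
begin

text \<open>Binary words of length \<open>n\<close> are boolean lists, with \<open>True\<close> standing for the symbol 1.\<close>

definition words :: "nat \<Rightarrow> bool list set" where
  "words n = {x. length x = n}"

definition weight :: "bool list \<Rightarrow> nat" where
  "weight x = card {i. i < length x \<and> x ! i}"

definition hamming_dist :: "bool list \<Rightarrow> bool list \<Rightarrow> nat" where
  "hamming_dist x y = card {i. i < length x \<and> x ! i \<noteq> y ! i}"

definition is_code :: "nat \<Rightarrow> nat \<Rightarrow> bool list set \<Rightarrow> bool" where
  "is_code n d C \<longleftrightarrow> C \<subseteq> words n \<and> (\<forall>x\<in>C. \<forall>y\<in>C. x \<noteq> y \<longrightarrow> d \<le> hamming_dist x y)"

text \<open>
  The maximum \<open>A(n,d)\<close>, and below \<open>A(n,d,w)\<close>, \<open>T(w1,n1,w2,n2,d)\<close> and \<open>T'(w1,n1,w2,n2,d)\<close>.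
  Each ranges over a finite nonempty set of cardinalities (the empty code is always
  admissible), so \<open>Max\<close> is a true maximum; see \<open>finite_code_cards\<close> and \<open>is_code_empty\<close>.
\<close>

definition code_A :: "nat \<Rightarrow> nat \<Rightarrow> nat" where
  "code_A n d = Max {card C | C. is_code n d C}"

definition code_A_weight :: "nat \<Rightarrow> nat \<Rightarrow> nat \<Rightarrow> nat" where
  "code_A_weight n d w = Max {card C | C. is_code n d C \<and> (\<forall>x\<in>C. weight x = w)}"

definition code_T :: "nat \<Rightarrow> nat \<Rightarrow> nat \<Rightarrow> nat \<Rightarrow> nat \<Rightarrow> nat" where
  "code_T w1 n1 w2 n2 d = Max {card C | C. is_code (n1 + n2) d C \<and>
     (\<forall>x\<in>C. weight x = w1 + w2 \<and> weight (take n1 x) = w1)}"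

definition code_T' :: "nat \<Rightarrow> nat \<Rightarrow> nat \<Rightarrow> nat \<Rightarrow> nat \<Rightarrow> nat" where
  "code_T' w1 n1 w2 n2 d = Max {card C | C. is_code (n1 + n2) d C \<and>
     (\<forall>x\<in>C. weight x = w1 + w2 \<and> weight (take n1 x) \<le> w1)}"

lemma finite_words: "finite (words n)"
  using finite_lists_length_eq[of "UNIV :: bool set" n] by (simp add: words_def)

lemma finite_code_cards: "finite {card C | C. is_code n d C \<and> P C}"
proof (rule finite_subset)
  show "{card C | C. is_code n d C \<and> P C} \<subseteq> card ` Pow (words n)"
    by (auto simp: is_code_def)
qed (simp add: finite_words)

lemma is_code_empty: "is_code n d {}"
  by (simp add: is_code_def)

end

theory Submission
  imports Defs "HOL-Combinatorics.Permutations"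
begin

text \<open>
  Let a group of isometries \<open>G\<close> act transitively on a set of words \<open>X\<close>. Averaging
  \<open>|g C \<inter> S|\<close> over \<open>g \<in> G\<close> gives \<open>|C| |S| / |X|\<close>, and each term is at most the maximal size of
  a code inside \<open>S\<close>. The first bound uses the coordinate permutations on the words of
  weight \<open>w\<close>, the second one the translations on all words.
\<close>

section \<open>Averaging over a uniform action\<close>

text \<open>Transitivity enters as the assumption that every fibre of
  \<open>g \<mapsto> act g x\<close> has the same size \<open>N\<close>, as cosets of a stabiliser
  do. Double counting the pairs \<open>(x, g)\<close> with \<open>act g x\<close> in
  \<open>S\<close> then gives the bound.\<close>

lemma card_mult_le_of_uniform_action:
  fixes act :: "'g \<Rightarrow> 'a \<Rightarrow> 'a"
  assumes fin: "finite G" "finite X" and sub: "C \<subseteq> X" "S \<subseteq> X"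
    and closed: "\<And>g x. g \<in> G \<Longrightarrow> x \<in> X \<Longrightarrow> act g x \<in> X"
    and uniform: "\<And>x y. x \<in> X \<Longrightarrow> y \<in> X \<Longrightarrow> card {g \<in> G. act g x = y} = N"
    and "N > 0"
    and bound: "\<And>g. g \<in> G \<Longrightarrow> card {x \<in> C. act g x \<in> S} \<le> T"
  shows "card C * card S \<le> card X * T"
proof (cases "C = {}")
  case False
  then obtain x0 where x0: "x0 \<in> X" using sub by auto
  have finCS: "finite C" "finite S" using fin sub finite_subset by auto
  have hits: "card {g \<in> G. act g x \<in> Y} = N * card Y" if "x \<in> X" "Y \<subseteq> X" for x Y
  proof -
    have "card {g \<in> G. act g x \<in> Y} = card (\<Union>y\<in>Y. {g \<in> G. act g x = y})"
      by (rule arg_cong[where f = card]) auto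
    also have "\<dots> = (\<Sum>y\<in>Y. card {g \<in> G. act g x = y})"
      using fin that by (intro card_UN_disjoint) (auto intro: finite_subset)
    also have "\<dots> = (\<Sum>y\<in>Y. N)"
      using uniform that by (intro sum.cong) auto
    finally show ?thesis by simp
  qed
  \<comment> \<open>Taking all of \<open>X\<close> as target determines the size of
    \<open>G\<close>, so the factor \<open>N\<close> cancels at the end.\<close>
  have "{g \<in> G. act g x0 \<in> X} = G" using closed x0 by auto
  with hits[OF x0, of X] have cardG: "card G = N * card X" by simp
  have "N * (card C * card S) = (\<Sum>x\<in>C. card {g \<in> G. act g x \<in> S})"
    using hits sub by (simp add: subset_iff)
  also have "\<dots> = (\<Sum>g\<in>G. card {x \<in> C. act g x \<in> S})"
    using fin finCS by (intro sum_multicount_gen) auto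
  also have "\<dots> \<le> card G * T"
    using sum_bounded_above[of G "\<lambda>g. card {x \<in> C. act g x \<in> S}" T] bound by simp
  also have "\<dots> = N * (card X * T)" by (simp add: cardG)
  finally show ?thesis using \<open>N > 0\<close> by simp
qed simp

section \<open>Extremal codes and isometric images\<close>

lemma card_le_Max_code_cards:
  assumes "is_code n d C" "P C"
  shows "card C \<le> Max {card C | C. is_code n d C \<and> P C}"
  using assms by (intro Max_ge finite_code_cards) auto

text \<open>\<open>P {}\<close> makes the empty code admissible, so the maximum is over a nonempty
  finite set.\<close>

lemma Max_code_cards_attained:
  assumes "P {}"
  obtains C where "is_code n d C" "P C" "Max {card C | C. is_code n d C \<and> P C} = card C"
proof -
  have "Max {card C | C. is_code n d C \<and> P C} \<in> {card C | C. is_code n d C \<and> P C}"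
    using assms is_code_empty by (intro Max_in finite_code_cards) blast
  then show ?thesis using that by auto
qed

text \<open>The part of \<open>C\<close> that an isometry \<open>f\<close> carries into
  \<open>S\<close> becomes a code inside \<open>S\<close> of the same size. This bounds each term of
  the average by the maximum over codes in \<open>S\<close>.\<close>

lemma is_code_image_Int:
  assumes C: "is_code n d C"
    and words: "\<And>x. x \<in> words n \<Longrightarrow> f x \<in> words n"
    and inj: "inj_on f (words n)"
    and isometry: "\<And>x y. x \<in> words n \<Longrightarrow> y \<in> words n \<Longrightarrow> hamming_dist (f x) (f y) = hamming_dist x y"
  shows "is_code n d (f ` {x \<in> C. f x \<in> S})" "card (f ` {x \<in> C. f x \<in> S}) = card {x \<in> C. f x \<in> S}"
proof -
  have sub: "C \<subseteq> words n" using C by (simp add: is_code_def)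
  show "is_code n d (f ` {x \<in> C. f x \<in> S})"
    unfolding is_code_def
  proof (intro conjI ballI impI)
    show "f ` {x \<in> C. f x \<in> S} \<subseteq> words n" using sub words by auto
  next
    fix u v assume "u \<in> f ` {x \<in> C. f x \<in> S}" "v \<in> f ` {x \<in> C. f x \<in> S}" "u \<noteq> v"
    then obtain x y where xy: "x \<in> C" "y \<in> C" "u = f x" "v = f y" "x \<noteq> y" by auto
    then have "hamming_dist u v = hamming_dist x y" using sub isometry by auto
    then show "d \<le> hamming_dist u v" using C xy by (auto simp: is_code_def)
  qed
  show "card (f ` {x \<in> C. f x \<in> S}) = card {x \<in> C. f x \<in> S}"
    using sub by (intro card_image inj_on_subset[OF inj]) auto
qed

subsection \<open>Counting words by weight\<close>

text \<open>In multiset form, additivity under append and invariance under permutation are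
  immediate.\<close>

lemma weight_eq_count: "weight x = count (mset x) True"
  by (simp add: weight_def count_mset count_list_eq_length_filter length_filter_conv_card)

lemma weight_append: "weight (x @ y) = weight x + weight y"
  by (simp add: weight_eq_count)

lemma card_words: "card (words n) = 2 ^ n"
  using card_lists_length_eq[of "UNIV :: bool set" n] by (simp add: words_def)

text \<open>A word is determined by its support, a \<open>w\<close>-element subset of the
  \<open>n\<close> positions.\<close>

lemma card_words_weight: "card {x \<in> words n. weight x = w} = n choose w"
proof -
  have "bij_betw (\<lambda>x. {i. i < n \<and> x ! i}) {x \<in> words n. weight x = w}
          {A. A \<subseteq> {..<n} \<and> card A = w}"
  proof (rule bij_betw_byWitness[where f' = "\<lambda>A. map (\<lambda>i. i \<in> A) [0..<n]"])
    show "\<forall>A\<in>{A. A \<subseteq> {..<n} \<and> card A = w}. {i. i < n \<and> map (\<lambda>i. i \<in> A) [0..<n] ! i} = A"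
      by auto
    show "(\<lambda>A. map (\<lambda>i. i \<in> A) [0..<n]) ` {A. A \<subseteq> {..<n} \<and> card A = w}
            \<subseteq> {x \<in> words n. weight x = w}"
    proof safe
      fix A :: "nat set" assume A: "A \<subseteq> {..<n}"
      then have "{i. i < n \<and> map (\<lambda>i. i \<in> A) [0..<n] ! i} = A" by auto
      then show "weight (map (\<lambda>i. i \<in> A) [0..<n]) = card A" by (simp add: weight_def)
    qed (simp add: words_def)
  qed (auto simp: words_def weight_def intro!: nth_equalityI)
  then show ?thesis using n_subsets[of "{..<n}" w] by (simp add: bij_betw_same_card)
qed

lemma card_words_split_weight:
  "card {x \<in> words (n1 + n2). weight (take n1 x) = i \<and> weight x = i + j}
     = (n1 choose i) * (n2 choose j)"
proof -
  let ?P = "{x \<in> words n1. weight x = i} \<times> {y \<in> words n2. weight y = j}"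
  have "bij_betw (\<lambda>(x, y). x @ y) ?P
          {x \<in> words (n1 + n2). weight (take n1 x) = i \<and> weight x = i + j}"
  proof (rule bij_betw_byWitness[where f' = "\<lambda>x. (take n1 x, drop n1 x)"])
    show "(\<lambda>x. (take n1 x, drop n1 x)) `
            {x \<in> words (n1 + n2). weight (take n1 x) = i \<and> weight x = i + j} \<subseteq> ?P"
    proof (clarsimp simp: words_def)
      fix x assume "weight x = weight (take n1 x) + j"
      moreover have "weight x = weight (take n1 x) + weight (drop n1 x)"
        by (simp flip: weight_append)
      ultimately show "weight (drop n1 x) = j" by simp
    qed
  qed (auto simp: words_def weight_append)
  then show ?thesis by (simp add: bij_betw_same_card[symmetric] card_cartesian_product card_words_weight)
qed

lemma card_words_split_weight_le:
  "card {x \<in> words (n1 + n2). weight x = w1 + w2 \<and> weight (take n1 x) \<le> w1}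
     = (\<Sum>i = 0..w1. (n1 choose i) * (n2 choose (w1 + w2 - i)))"
proof -
  \<comment> \<open>The total weight is written as \<open>i + (w1 + w2 - i)\<close> to match the
    previous count; for \<open>i \<le> w1\<close> the subtraction does not truncate.\<close>
  define S where
    "S i = {x \<in> words (n1 + n2). weight (take n1 x) = i \<and> weight x = i + (w1 + w2 - i)}" for i
  have fin: "finite (S i)" for i
    by (simp add: S_def finite_words)
  have disj: "S i \<inter> S j = {}" if "i \<noteq> j" for i j
    using that by (auto simp only: S_def)
  have "{x \<in> words (n1 + n2). weight x = w1 + w2 \<and> weight (take n1 x) \<le> w1} = (\<Union>i\<in>{0..w1}. S i)"
    by (simp add: S_def set_eq_iff) (metis le_add1 le_trans le_add_diff_inverse)
  also have "card \<dots> = (\<Sum>i = 0..w1. card (S i))"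
    using fin disj by (intro card_UN_disjoint) simp_all
  finally show ?thesis by (simp only: S_def card_words_split_weight)
qed

subsection \<open>Coordinate permutations\<close>

lemma weight_permute_list: "p permutes {..<length x} \<Longrightarrow> weight (permute_list p x) = weight x"
  by (simp add: weight_eq_count)

text \<open>The positions where the permuted words differ are the preimage under the bijection
  \<open>p\<close> of those where \<open>x\<close> and \<open>y\<close> differ.\<close>

lemma hamming_dist_permute_list:
  assumes "p permutes {..<n}" "x \<in> words n" "y \<in> words n"
  shows "hamming_dist (permute_list p x) (permute_list p y) = hamming_dist x y"
proof -
  have len: "length x = n" "length y = n" using assms by (auto simp: words_def)
  have lt: "p i < n \<longleftrightarrow> i < n" for i
    using permutes_in_image[OF assms(1), of i] by simp
  have "{i. i < n \<and> permute_list p x ! i \<noteq> permute_list p y ! i} = p -` {i. i < n \<and> x ! i \<noteq> y ! i}"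
    using assms(1) len lt by (simp add: set_eq_iff permute_list_nth cong: conj_cong)
  moreover have "card (p -` {i. i < n \<and> x ! i \<noteq> y ! i}) = card {i. i < n \<and> x ! i \<noteq> y ! i}"
    using permutes_inj[OF assms(1)] permutes_surj[OF assms(1)] by (intro card_vimage_inj) auto
  ultimately show ?thesis by (simp add: hamming_dist_def len)
qed

lemma inj_on_permute_list:
  assumes "p permutes {..<n}"
  shows "inj_on (permute_list p) (words n)"
proof (rule inj_on_inverseI)
  fix x :: "bool list" assume "x \<in> words n"
  then show "permute_list (inv p) (permute_list p x) = x"
    using assms permute_list_compose[of "inv p" x p]
    by (simp add: words_def permutes_inv permutes_inv_o)
qed

text \<open>Transitivity on each weight class: equal length and equally many \<open>True\<close>
  entries force equally many \<open>False\<close> entries, hence equal multisets.\<close>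

lemma ex_permute_list_eq:
  assumes "x \<in> words n" "y \<in> words n" "weight x = weight y"
  obtains p where "p permutes {..<n}" "permute_list p x = y"
proof -
  have "count (mset z) False + count (mset z) True = length z" for z
    by (induction z) auto
  from this[of x] this[of y]
  have "count (mset x) False + count (mset x) True = count (mset y) False + count (mset y) True"
    using assms by (simp add: words_def)
  then have "count (mset x) b = count (mset y) b" for b
    using assms(3) by (cases b) (auto simp: weight_eq_count)
  then have "mset y = mset x" by (intro multiset_eqI) simp
  then obtain p where "p permutes {..<length x}" "permute_list p x = y"
    by (rule mset_eq_permutation)
  then show ?thesis using assms(1) that by (simp add: words_def)
qed

text \<open>All these fibres are cosets of the stabiliser of a single word.\<close>

lemma card_permute_list_fibre:
  assumes "x0 \<in> words n" "x \<in> words n" "y \<in> words n" "weight x = weight x0" "weight y = weight x0"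
  shows "card {p \<in> {p. p permutes {..<n}}. permute_list p x = y}
       = card {p. p permutes {..<n} \<and> permute_list p x0 = x0}"
proof -
  obtain q where q: "q permutes {..<n}" "permute_list q x0 = x"
    using ex_permute_list_eq[of x0 n x] assms by auto
  obtain r where r: "r permutes {..<n}" "permute_list r y = x0"
    using ex_permute_list_eq[of y n x0] assms by auto
  have q': "permute_list (inv q) x = x0" and r': "permute_list (inv r) x0 = y"
    using q r assms permute_list_compose[of "inv q" x0 q] permute_list_compose[of "inv r" y r]
    by (auto simp: words_def permutes_inv permutes_inv_o)
  \<comment> \<open>\<open>permute_list\<close> acts from the right, so
    \<open>q \<circ> p \<circ> r\<close> applies \<open>q\<close> first: it leads from
    \<open>x0\<close> to \<open>x\<close>, then by \<open>p\<close> to \<open>y\<close>, and by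
    \<open>r\<close> back to \<open>x0\<close>.\<close>
  have compose: "permute_list (f \<circ> g) z = permute_list g (permute_list f z)"
    if "g permutes {..<n}" "z \<in> words n" for f g and z :: "bool list"
    using that by (simp add: permute_list_compose words_def)
  have "bij_betw (\<lambda>p. q \<circ> p \<circ> r) {p \<in> {p. p permutes {..<n}}. permute_list p x = y}
      {p. p permutes {..<n} \<and> permute_list p x0 = x0}"
  proof (rule bij_betw_byWitness[where f' = "\<lambda>p. inv q \<circ> p \<circ> inv r"])
    show "\<forall>p\<in>{p \<in> {p. p permutes {..<n}}. permute_list p x = y}. inv q \<circ> (q \<circ> p \<circ> r) \<circ> inv r = p"
      using permutes_inverses[OF q(1)] permutes_inverses[OF r(1)] by (auto simp: fun_eq_iff)
    show "\<forall>p\<in>{p. p permutes {..<n} \<and> permute_list p x0 = x0}. q \<circ> (inv q \<circ> p \<circ> inv r) \<circ> r = p"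
      using permutes_inverses[OF q(1)] permutes_inverses[OF r(1)] by (auto simp: fun_eq_iff)
    show "(\<lambda>p. q \<circ> p \<circ> r) ` {p \<in> {p. p permutes {..<n}}. permute_list p x = y}
        \<subseteq> {p. p permutes {..<n} \<and> permute_list p x0 = x0}"
    proof (rule image_subsetI)
      fix p assume "p \<in> {p \<in> {p. p permutes {..<n}}. permute_list p x = y}"
      then have p: "p permutes {..<n}" "permute_list p x = y" by simp_all
      have "permute_list (q \<circ> p \<circ> r) x0 = permute_list r (permute_list p (permute_list q x0))"
        using compose[OF r(1)] compose[OF p(1)] assms(1) by simp
      then show "q \<circ> p \<circ> r \<in> {p. p permutes {..<n} \<and> permute_list p x0 = x0}"
        using q r p by (simp add: permutes_compose)
    qed
    show "(\<lambda>p. inv q \<circ> p \<circ> inv r) ` {p. p permutes {..<n} \<and> permute_list p x0 = x0}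
        \<subseteq> {p \<in> {p. p permutes {..<n}}. permute_list p x = y}"
    proof (rule image_subsetI)
      fix p assume "p \<in> {p. p permutes {..<n} \<and> permute_list p x0 = x0}"
      then have p: "p permutes {..<n}" "permute_list p x0 = x0" by simp_all
      have "permute_list (inv q \<circ> p \<circ> inv r) x
          = permute_list (inv r) (permute_list p (permute_list (inv q) x))"
        using compose[OF permutes_inv[OF r(1)]] compose[OF p(1)] assms(2) by simp
      then have "permute_list (inv q \<circ> p \<circ> inv r) x = y"
        using q' r' p by simp
      then show "inv q \<circ> p \<circ> inv r \<in> {p \<in> {p. p permutes {..<n}}. permute_list p x = y}"
        using q(1) r(1) p(1) by (simp add: permutes_compose permutes_inv)
    qed
  qed
  then show ?thesis by (rule bij_betw_same_card)
qed

text \<open>The averaging bound for an optimal constant-weight code \<open>C\<close>, with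
  \<open>X\<close> all words of weight \<open>w\<close> and \<open>S\<close> those with
  \<open>w1\<close> ones in the first block.\<close>

lemma code_A_weight_mult_le:
  "code_A_weight (n1 + n2) d (w1 + w2) * ((n1 choose w1) * (n2 choose w2))
     \<le> ((n1 + n2) choose (w1 + w2)) * code_T w1 n1 w2 n2 d"
proof -
  define n where "n = n1 + n2"
  define w where "w = w1 + w2"
  define X where "X = {x \<in> words n. weight x = w}"
  define S where "S = {x \<in> words n. weight (take n1 x) = w1 \<and> weight x = w1 + w2}"
  obtain C where C: "is_code n d C" "\<forall>x\<in>C. weight x = w" "code_A_weight n d w = card C"
    unfolding code_A_weight_def by (rule Max_code_cards_attained[of "\<lambda>C. \<forall>x\<in>C. weight x = w"]) auto
  have "card C * card S \<le> card X * code_T w1 n1 w2 n2 d"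
  \<comment> \<open>The fibre size is the order of the stabiliser of some word \<open>x0\<close> of
    weight \<open>w\<close>, so such a word has to exist.\<close>
  proof (cases "X = {}")
    case True
    then have "C = {}" using C by (auto simp: X_def is_code_def)
    then show ?thesis by simp
  next
    case False
    then obtain x0 where x0: "x0 \<in> X" by auto
    show ?thesis
    proof (rule card_mult_le_of_uniform_action[where G = "{p. p permutes {..<n}}" and act = permute_list
            and N = "card {p. p permutes {..<n} \<and> permute_list p x0 = x0}"])
      show "finite {p. p permutes {..<n}}" by (simp add: finite_permutations)
      show "finite X" by (simp add: X_def finite_words)
      show "C \<subseteq> X" using C by (auto simp: X_def is_code_def)
      show "S \<subseteq> X" by (auto simp: X_def S_def w_def)
      show "permute_list p x \<in> X" if "p \<in> {p. p permutes {..<n}}" "x \<in> X" for p x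
        using that by (auto simp: X_def words_def weight_permute_list)
      show "card {p \<in> {p. p permutes {..<n}}. permute_list p x = y}
          = card {p. p permutes {..<n} \<and> permute_list p x0 = x0}" if "x \<in> X" "y \<in> X" for x y
        using that x0 by (intro card_permute_list_fibre) (auto simp: X_def)
      have "id \<in> {p. p permutes {..<n} \<and> permute_list p x0 = x0}"
        by (simp add: permutes_id)
      moreover have "finite {p. p permutes {..<n} \<and> permute_list p x0 = x0}"
        by (rule finite_subset[OF _ finite_permutations[of "{..<n}"]]) auto
      ultimately show "0 < card {p. p permutes {..<n} \<and> permute_list p x0 = x0}"
        using card_gt_0_iff by blast
    next
      fix p assume "p \<in> {p. p permutes {..<n}}"
      then have p: "p permutes {..<n}" by simp
      note image = is_code_image_Int[OF C(1) _ inj_on_permute_list[OF p]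
          hamming_dist_permute_list[OF p], of S]
      show "card {x \<in> C. permute_list p x \<in> S} \<le> code_T w1 n1 w2 n2 d"
        unfolding code_T_def
      \<comment> \<open>Passing to the image under \<open>p\<close> turns the count into the size of
        a code admissible for \<open>code_T\<close>.\<close>
      proof (subst image(2)[symmetric])
        show "card (permute_list p ` {x \<in> C. permute_list p x \<in> S}) \<le>
          Max {card C |C. is_code (n1 + n2) d C \<and>
            (\<forall>x\<in>C. weight x = w1 + w2 \<and> weight (take n1 x) = w1)}"
          using image(1) by (intro card_le_Max_code_cards) (auto simp: n_def S_def words_def)
      qed (auto simp: words_def)
    qed
  qed
  then show ?thesis
    using C(3) card_words_split_weight[of n1 n2 w1 w2] card_words_weight[of n w]
    by (simp add: X_def S_def n_def w_def)
qed

subsection \<open>Translations\<close>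

text \<open>On booleans \<open>\<noteq>\<close> is exclusive or, so this is vector addition over the
  two-element field.\<close>

definition translate :: "bool list \<Rightarrow> bool list \<Rightarrow> bool list" where
  "translate v x = map2 (\<noteq>) v x"

lemma translate_words: "v \<in> words n \<Longrightarrow> x \<in> words n \<Longrightarrow> translate v x \<in> words n"
  by (simp add: translate_def words_def)

text \<open>Every vector is its own additive inverse, so exactly one translation takes
  \<open>x\<close> to \<open>y\<close>. The action is regular, with fibres of size 1.\<close>

lemma translate_eq_iff:
  assumes "v \<in> words n" "x \<in> words n" "y \<in> words n"
  shows "translate v x = y \<longleftrightarrow> v = translate x y"
  using assms by (auto simp: translate_def words_def list_eq_iff_nth_eq)

lemma inj_on_translate: "v \<in> words n \<Longrightarrow> inj_on (translate v) (words n)"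
  by (auto simp: inj_on_def translate_def words_def list_eq_iff_nth_eq)

lemma hamming_dist_translate:
  assumes "v \<in> words n" "x \<in> words n" "y \<in> words n"
  shows "hamming_dist (translate v x) (translate v y) = hamming_dist x y"
  unfolding hamming_dist_def using assms
  by (intro arg_cong[where f = card]) (auto simp: translate_def words_def)

text \<open>The averaging bound for an optimal code \<open>C\<close>, with \<open>X\<close> and the
  set of translations both equal to \<open>words n\<close>.\<close>

lemma code_A_mult_le:
  "code_A (n1 + n2) d * (\<Sum>i = 0..w1. (n1 choose i) * (n2 choose (w1 + w2 - i)))
     \<le> 2 ^ (n1 + n2) * code_T' w1 n1 w2 n2 d"
proof -
  define n where "n = n1 + n2"
  define S where "S = {x \<in> words n. weight x = w1 + w2 \<and> weight (take n1 x) \<le> w1}"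
  obtain C where C: "is_code n d C" "code_A n d = card C"
    using Max_code_cards_attained[of "\<lambda>_. True" n d] by (auto simp: code_A_def)
  have "card C * card S \<le> card (words n) * code_T' w1 n1 w2 n2 d"
  proof (rule card_mult_le_of_uniform_action[where G = "words n" and act = translate and N = 1])
    show "C \<subseteq> words n" using C by (simp add: is_code_def)
    show "S \<subseteq> words n" by (auto simp: S_def)
    show "card {v \<in> words n. translate v x = y} = 1" if "x \<in> words n" "y \<in> words n" for x y
    proof -
      have "{v \<in> words n. translate v x = y} = {translate x y}"
        using that translate_eq_iff[OF _ that] translate_words[OF that] by auto
      then show ?thesis by simp
    qed
  next
    fix v assume v: "v \<in> words n"
    note image = is_code_image_Int[OF C(1) translate_words[OF v] inj_on_translate[OF v]
        hamming_dist_translate[OF v], of S]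
    show "card {x \<in> C. translate v x \<in> S} \<le> code_T' w1 n1 w2 n2 d"
      unfolding code_T'_def
    proof (subst image(2)[symmetric])
      show "card (translate v ` {x \<in> C. translate v x \<in> S}) \<le>
        Max {card C |C. is_code (n1 + n2) d C \<and>
          (\<forall>x\<in>C. weight x = w1 + w2 \<and> weight (take n1 x) \<le> w1)}"
        using image(1) by (intro card_le_Max_code_cards) (auto simp: n_def S_def)
    qed
  qed (auto simp: finite_words translate_words)
  then show ?thesis
    using C(2) card_words_split_weight_le[of n1 n2 w1 w2] by (simp add: card_words S_def n_def)
qed

section \<open>From products to quotients\<close>

theorem lemma15:
  fixes n1 n2 w1 w2 n w d :: nat
  assumes "w1 \<le> n1" and "w2 \<le> n2"
    and "n = n1 + n2" and "w = w1 + w2"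
    and "1 \<le> d" and "d \<le> n"
  shows "real (code_A_weight n d w)
           \<le> real ((n1 + n2) choose (w1 + w2)) / (real (n1 choose w1) * real (n2 choose w2))
              * real (code_T w1 n1 w2 n2 d)
       \<and> real (code_A n d)
           \<le> 2 ^ n / (\<Sum>i = 0..w1. real (n1 choose i) * real (n2 choose (w1 + w2 - i)))
              * real (code_T' w1 n1 w2 n2 d)"
proof
  have pos: "(n1 choose w1) * (n2 choose w2) > 0" using assms by simp
  have "real (code_A_weight n d w * ((n1 choose w1) * (n2 choose w2)))
      \<le> real (((n1 + n2) choose (w1 + w2)) * code_T w1 n1 w2 n2 d)"
    unfolding assms(3,4) of_nat_le_iff by (rule code_A_weight_mult_le)
  then show "real (code_A_weight n d w)
      \<le> real ((n1 + n2) choose (w1 + w2)) / (real (n1 choose w1) * real (n2 choose w2))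
         * real (code_T w1 n1 w2 n2 d)"
    using pos by (simp add: pos_le_divide_eq del: of_nat_add)
next
  let ?s = "\<Sum>i = 0..w1. (n1 choose i) * (n2 choose (w1 + w2 - i))"
  \<comment> \<open>The term at \<open>i = w1\<close> is already positive, so the denominator is
    nonzero.\<close>
  have "(n1 choose w1) * (n2 choose (w1 + w2 - w1)) \<le> ?s"
    by (rule member_le_sum) auto
  moreover have "(n1 choose w1) * (n2 choose (w1 + w2 - w1)) > 0" using assms by simp
  ultimately have pos: "real ?s > 0" by linarith
  have "real (code_A n d * ?s) \<le> real (2 ^ n * code_T' w1 n1 w2 n2 d)"
    unfolding assms(3) of_nat_le_iff by (rule code_A_mult_le)
  then have "real (code_A n d) \<le> 2 ^ n / real ?s * real (code_T' w1 n1 w2 n2 d)"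
    using pos by (simp add: pos_le_divide_eq del: of_nat_sum)
  then show "real (code_A n d)
      \<le> 2 ^ n / (\<Sum>i = 0..w1. real (n1 choose i) * real (n2 choose (w1 + w2 - i)))
         * real (code_T' w1 n1 w2 n2 d)"
    by simp
qed

end
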